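(* Let $k>0$. For $\lambda,\rho,v\in\mathbb{C}$ with $\Re\left(\frac{v}{k}\right)>-1$, $\Re(\lambda+\rho)>0$, $\Re\left(\lambda+\frac{v}{k}\right)>0$ and $z>0$ (where $z$ is the variable of integration), the following holds, $y$ being a parameter: $$\int_{0}^{1}z^{\lambda+\rho-1}(1-z)^{2\lambda-1}\left(1-\frac{z}{3}\right)^{2(\lambda+\rho)-1}\left(1-\frac{z}{4}\right)^{\lambda-1}J_{v}^{k}\left(\frac{y\left(1-\frac{z}{4}\right)(1-z)^2}{2}\right)dz$$ $$=\frac{\left(\frac{y}{2}\right)^{v/k}\,\Gamma(\lambda+\rho)\left(\frac{2}{3}\right)^{2(\lambda+\rho)}}{k^{v/k}}\;{}_1\Psi_{2}\left[\begin{array}{c}\left(\lambda+\frac{v}{k},2\right)\\ \left(\frac{v}{k}+1,1\right),\ \left(2\lambda+\frac{v}{k}+\rho,2\right)\end{array};\ -\frac{y^2}{4k}\right].$$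
   Context: The $k$-gamma function is $\Gamma_k(s)=\int_0^\infty t^{s-1}e^{-t^k/k}\,dt$, and satisfies $\Gamma_k(s)=k^{\frac{s}{k}-1}\Gamma(s/k)$, where $\Gamma$ is the gamma function. The classical $k$-Bessel function is given, for $k>0$, by $$J_{v}^{k}(x)=\sum_{n=0}^{\infty}\frac{(-1)^n}{\Gamma_k(v+nk+k)\,n!}\left(\frac{x}{2}\right)^{\frac{v}{k}+2n}.$$ The Wright-type hypergeometric function is $${}_1\Psi_2\left[\begin{array}{c}(\alpha_1,A_1)\\(\beta_1,B_1),(\beta_2,B_2)\end{array};x\right]=\sum_{n=0}^\infty\frac{\Gamma(\alpha_1+A_1n)}{\Gamma(\beta_1+B_1n)\Gamma(\beta_2+B_2n)}\frac{x^n}{n!}.$$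
   Formalization: The argument of the k-Bessel function is taken as y(1-z/4)(1-z)^2 without the printed division by 2; as printed the two sides differ, since the series already contains x/2 and the right side would need y/4 and -y^2/(16k). *)

theory Defs
  imports "HOL-Analysis.Analysis"
begin

(* Principal value of a power, with x to the power 0 equal to 1 for every x.  The only difference
   from powr is at x = 0, where powr has 0 powr 0 = 0: used in the Bessel series, that would give
   J_0(0) = 0 instead of 1. *)
definition cpow :: "complex \<Rightarrow> complex \<Rightarrow> complex" where
  "cpow x s = (if s = 0 then 1 else x powr s)"

(* The integral converges for k > 0 and Re s > 0; no analytic continuation is included. *)
definition k_Gamma :: "real \<Rightarrow> complex \<Rightarrow> complex" where
  "k_Gamma k s =
     integral {0..} (\<lambda>t::real. of_real t powr (s - 1) * of_real (exp (- (t powr k / k))))"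

definition k_Bessel :: "real \<Rightarrow> complex \<Rightarrow> complex \<Rightarrow> complex" where
  "k_Bessel k v x =
     (\<Sum>n. (-1) ^ n / (k_Gamma k (v + of_nat n * of_real k + of_real k) * fact n)
           * cpow (x / 2) (v / of_real k + 2 * of_nat n))"

(* Gamma is 0 at its poles and division by 0 gives 0, so a summand in which a Gamma function of
   the denominator has a pole is 0, as it should be. *)
definition Wright_1Psi2 ::
  "complex \<times> real \<Rightarrow> complex \<times> real \<Rightarrow> complex \<times> real \<Rightarrow> complex \<Rightarrow> complex" where
  "Wright_1Psi2 = (\<lambda>(a1, A1) (b1, B1) (b2, B2) x.
     (\<Sum>n. Gamma (a1 + of_real A1 * of_nat n)
           / (Gamma (b1 + of_real B1 * of_nat n) * Gamma (b2 + of_real B2 * of_nat n))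
           * (x ^ n / fact n)))"

end

theory Submission
  imports Defs
begin

text \<open>
  Put \<open>w = 9/4 z (1 - z/3)\<^sup>2\<close>. Then \<open>1 - w = (1 - z/4) (1 - z)\<^sup>2\<close> and \<open>dw/dz = 9/4 (1 - z) (1 - z/3)\<close>,
  so this substitution turns the Lavoie--Trottier integral
  \<open>\<integral>\<^sub>0\<^sup>1 z\<^bsup>a-1\<^esup> (1 - z)\<^bsup>2b-1\<^esup> (1 - z/3)\<^bsup>2a-1\<^esup> (1 - z/4)\<^bsup>b-1\<^esup> dz\<close> into \<open>(4/9)\<^bsup>a\<^esup> B(a, b)\<close>.
  The \<open>n\<close>-th term of the Bessel series multiplies the integrand by a constant times
  \<open>(1 - w)\<^bsup>v/k + 2n\<^esup>\<close>, that is, it replaces \<open>b = \<lambda>\<close> by \<open>\<lambda> + v/k + 2n\<close>. As \<open>0 < 1 - w < 1\<close>, the partial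
  sums are dominated by a multiple of the integrand for \<open>n = 0\<close>, and integration is termwise.
\<close>

section \<open>Gamma integrals and the k-gamma function\<close>

text \<open>Fubini is applied over \<open>lborel\<close>, whereas change of variables and absolute
  integrability refer to \<open>lebesgue\<close>; this carries the result of the former to the
  latter.\<close>

lemma has_bochner_integral_lborel_imp_lebesgue:
  fixes f :: "'a::euclidean_space \<Rightarrow> 'b::{banach, second_countable_topology}"
  assumes "has_bochner_integral lborel f x"
  shows "has_bochner_integral lebesgue f x"
proof -
  have "f \<in> borel_measurable lborel"
    using assms by (auto simp only: has_bochner_integral_iff intro: borel_measurable_integrable)
  from integrable_completion[OF this] integral_completion[OF this] show ?thesis
    using assms by (simp add: has_bochner_integral_iff)
qed

text \<open>\<open>t\<^bsup>s-1\<^esup> exp (- p t)\<close> for \<open>t > 0\<close>, written without \<^const>\<open>powr\<close> so that joint measurability in \<open>p\<close> and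
  \<open>t\<close> is automatic.\<close>
definition gamma_kernel :: "complex \<Rightarrow> real \<Rightarrow> real \<Rightarrow> complex" where
  "gamma_kernel s p t = indicator {0<..} t *\<^sub>R exp ((s - 1) * of_real (ln t) - of_real (p * t))"

lemma measurable_gamma_kernel [measurable]:
  assumes [measurable]: "f \<in> borel_measurable M" "g \<in> borel_measurable M"
  shows "(\<lambda>x. gamma_kernel s (f x) (g x)) \<in> borel_measurable M"
proof -
  have [measurable]: "(exp :: complex \<Rightarrow> complex) \<in> borel_measurable borel"
    by (intro borel_measurable_continuous_onI continuous_intros)
  show ?thesis
    unfolding gamma_kernel_def by measurable
qed

text \<open>The imaginary part of \<open>s\<close> contributes only a factor of modulus 1. Integrals
  of norms, as Fubini requires them, are thus gamma integrals again.\<close>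

lemma norm_gamma_kernel: "norm (gamma_kernel s p t) = Re (gamma_kernel (of_real (Re s)) p t)"
  by (auto simp: gamma_kernel_def indicator_def Re_exp)

lemma of_real_powr_eq_exp:
  "t > 0 \<Longrightarrow> complex_of_real t powr s = exp (s * of_real (ln t))"
  by (simp add: powr_def Ln_of_real)

text \<open>Change of variables in Euler's integral, used twice: with \<open>g t = p * t\<close> for
  the scaled kernel and with \<open>g t = t powr k / k\<close> for the k-gamma function.\<close>

lemma gamma_substitution:
  fixes g g' :: "real \<Rightarrow> real"
  assumes "Re s > 0"
    and "\<And>t. t > 0 \<Longrightarrow> (g has_field_derivative g' t) (at t within {0<..})"
    and "inj_on g {0<..}" "g ` {0<..} = {0<..}"
  shows "(\<lambda>t. \<bar>g' t\<bar> *\<^sub>R (of_real (g t) powr (s - 1) / of_real (exp (g t))))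
           absolutely_integrable_on {0<..}"
    and "((\<lambda>t. \<bar>g' t\<bar> *\<^sub>R (of_real (g t) powr (s - 1) / of_real (exp (g t))))
           has_integral Gamma s) {0<..}"
proof -
  let ?f = "\<lambda>t::real. complex_of_real t powr (s - 1) / of_real (exp t)"
  have "(\<lambda>t. \<bar>g' t\<bar> *\<^sub>R ?f (g t)) absolutely_integrable_on {0<..} \<and>
      integral {0<..} (\<lambda>t. \<bar>g' t\<bar> *\<^sub>R ?f (g t)) = Gamma s"
    using has_absolute_integral_change_of_variables_real[of "{0<..}" g g' ?f "Gamma s"] assms
      absolutely_integrable_Gamma_integral' Gamma_integral_complex'[THEN integral_unique]
    by simp
  then show "(\<lambda>t. \<bar>g' t\<bar> *\<^sub>R ?f (g t)) absolutely_integrable_on {0<..}"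
    and "((\<lambda>t. \<bar>g' t\<bar> *\<^sub>R ?f (g t)) has_integral Gamma s) {0<..}"
    using set_lebesgue_integral_eq_integral(1) by (auto simp: has_integral_iff)
qed

lemma has_bochner_integral_gamma_kernel:
  assumes "Re s > 0" "p > 0"
  shows "has_bochner_integral lborel (gamma_kernel s p) (Gamma s / of_real p powr s)"
proof -
  let ?f = "\<lambda>t. \<bar>p\<bar> *\<^sub>R (of_real (p * t) powr (s - 1) / complex_of_real (exp (p * t)))"
  have im: "(*) p ` {0<..} = {0<..}"
    using \<open>p > 0\<close> by (auto simp: image_iff intro!: bexI[of _ "_ / p"])
  have d: "((*) p has_field_derivative p) (at t within {0<..})" for t
    by (auto intro!: derivative_eq_intros)
  note sub = gamma_substitution[where g = "(*) p" and g' = "\<lambda>_. p", OF assms(1) d _ im]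
  have inj: "inj_on ((*) p) {0<..}"
    using \<open>p > 0\<close> by (simp add: inj_on_def)
  \<comment> \<open>The Jacobian p and the factor p^(s-1) of (p t)^(s-1) combine to p^s.\<close>
  have eq: "indicator {0<..} t *\<^sub>R ?f t = of_real p powr s * gamma_kernel s p t" for t
  proof (cases "t > 0")
    case True
    have "?f t = exp (of_real (ln p)) * exp ((s - 1) * of_real (ln p + ln t)) / exp (of_real (p * t))"
      using True \<open>p > 0\<close>
      by (simp add: of_real_powr_eq_exp ln_mult scaleR_conv_of_real exp_of_real del: of_real_mult)
    also have "\<dots> = of_real p powr s * gamma_kernel s p t"
      using True \<open>p > 0\<close>
      by (simp add: of_real_powr_eq_exp gamma_kernel_def flip: exp_add exp_diff)
         (simp add: algebra_simps)
    finally show ?thesis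
      using True by simp
  qed (simp add: gamma_kernel_def)
  have "has_bochner_integral lebesgue (\<lambda>t. of_real p powr s * gamma_kernel s p t) (Gamma s)"
    using sub(1)[OF inj] set_lebesgue_integral_eq_integral(2)[OF sub(1)[OF inj]]
    unfolding integral_unique[OF sub(2)[OF inj]]
    unfolding has_bochner_integral_iff set_integrable_def set_lebesgue_integral_def eq
    by simp
  \<comment> \<open>The kernel is Borel measurable, so its integral with respect to the completed
    measure is also one over \<open>lborel\<close>.\<close>
  then have "has_bochner_integral lborel (\<lambda>t. of_real p powr s * gamma_kernel s p t) (Gamma s)"
    unfolding has_bochner_integral_iff by (simp add: integrable_completion integral_completion)
  then have "has_bochner_integral lborel (\<lambda>t. of_real p powr s * gamma_kernel s p t / of_real p powr s)
      (Gamma s / of_real p powr s)"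
    by (rule has_bochner_integral_divide_zero)
  then show ?thesis
    using \<open>p > 0\<close> by simp
qed

lemma has_bochner_integral_norm_gamma_kernel:
  assumes "Re s > 0" "p > 0"
  shows "has_bochner_integral lborel (\<lambda>t. norm (gamma_kernel s p t)) (Gamma (Re s) / p powr Re s)"
proof -
  have "has_bochner_integral lborel (\<lambda>t. Re (gamma_kernel (of_real (Re s)) p t))
      (Re (Gamma (of_real (Re s)) / of_real p powr of_real (Re s)))"
    using assms
    by (intro has_bochner_integral_bounded_linear[OF bounded_linear_Re]
        has_bochner_integral_gamma_kernel) simp_all
  also have "Gamma (of_real (Re s)) / of_real p powr of_real (Re s) =
      complex_of_real (Gamma (Re s) / p powr Re s)"
    using \<open>p > 0\<close> by (simp add: powr_of_real Gamma_complex_of_real)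
  finally show ?thesis
    by (simp add: norm_gamma_kernel)
qed

text \<open>With u = t^k / k one has du = t^(k-1) dt and t^(s-k) = (k u)^(s/k - 1), hence t^(s-1) dt
  = k^(s/k - 1) u^(s/k - 1) du.\<close>

lemma k_Gamma_eq:
  assumes "k > 0" "Re s > 0"
  shows "k_Gamma k s = of_real k powr (s / of_real k - 1) * Gamma (s / of_real k)"
proof -
  let ?g = "\<lambda>t. t powr k / k"
  let ?f = "\<lambda>t. \<bar>t powr (k - 1)\<bar> *\<^sub>R (of_real (?g t) powr (s / of_real k - 1) /
              complex_of_real (exp (?g t)))"
  let ?h = "\<lambda>t::real. of_real t powr (s - 1) * complex_of_real (exp (- (t powr k / k)))"
  have "\<exists>t>0. x = t powr k / k" if "x > 0" for x
    using that \<open>k > 0\<close> by (intro exI[of _ "(k * x) powr (1 / k)"]) (simp add: powr_powr)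
  then have im: "?g ` {0<..} = {0<..}"
    using \<open>k > 0\<close> by (auto simp: image_iff)
  have inj: "inj_on ?g {0<..}"
    using \<open>k > 0\<close>
    by (intro inj_on_inverseI[where g = "\<lambda>x. (k * x) powr (1 / k)"]) (simp add: powr_powr)
  have d: "(?g has_field_derivative t powr (k - 1)) (at t within {0<..})" if "t > 0" for t
    using that \<open>k > 0\<close> by (auto intro!: derivative_eq_intros)
  have "Re (s / of_real k) > 0"
    using assms by simp
  from gamma_substitution(2)[OF this d inj im]
  have "(?f has_integral Gamma (s / of_real k)) {0<..}" .
  then have "((\<lambda>t. of_real k powr (s / of_real k - 1) * ?f t)
      has_integral of_real k powr (s / of_real k - 1) * Gamma (s / of_real k)) {0<..}"
    by (rule has_integral_mult_right)
  moreover have "of_real k powr (s / of_real k - 1) * ?f t = ?h t" if "t \<in> {0<..}" for t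
  proof -
    have "of_real k powr (s / of_real k - 1) * ?f t =
        exp ((s / of_real k - 1) * of_real (ln k)) * (exp (of_real ((k - 1) * ln t)) *
          (exp ((s / of_real k - 1) * of_real (k * ln t - ln k)) / of_real (exp (?g t))))"
      using that \<open>k > 0\<close>
      by (simp add: of_real_powr_eq_exp ln_div ln_powr scaleR_conv_of_real exp_of_real
          powr_def[of t "k - 1"] del: of_real_mult of_real_divide of_real_diff)
    also have "\<dots> = exp ((s - 1) * of_real (ln t)) / of_real (exp (?g t))"
      using \<open>k > 0\<close> by (simp flip: exp_add) (simp add: algebra_simps)
    also have "\<dots> = ?h t"
      using that by (simp add: of_real_powr_eq_exp exp_minus field_simps)
    finally show ?thesis .
  qed
  ultimately have "(?h has_integral of_real k powr (s / of_real k - 1) * Gamma (s / of_real k)) {0<..}"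
    by (rule has_integral_eq[rotated])
  moreover have "negligible {t \<in> {0<..} - {0..}. ?h t \<noteq> 0}" "negligible {t \<in> {0..} - {0<..}. ?h t \<noteq> 0}"
    by (rule negligible_subset[of "{0}"]; force)+
  ultimately have "(?h has_integral of_real k powr (s / of_real k - 1) * Gamma (s / of_real k)) {0..}"
    by (simp only: has_integral_spike_set_eq[of "{0<..}" "{0..}"])
  then show ?thesis
    unfolding k_Gamma_def by (rule integral_unique)
qed

section \<open>Euler's beta integral for complex parameters\<close>

text \<open>Fubini for \<open>x\<^bsup>b-1\<^esup> u\<^bsup>a+b-1\<^esup> exp (- u (1 + x))\<close> on the quadrant \<open>x, u > 0\<close>.\<close>
lemma complex_Beta_integral_Ioi:
  assumes "Re a > 0" "Re b > 0"
  shows "has_bochner_integral lborel (\<lambda>x. gamma_kernel b 0 x / of_real (1 + x) powr (a + b)) (Beta a b)"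
proof -
  let ?F = "\<lambda>u x. gamma_kernel (a + b) 1 u * gamma_kernel b u x"
  have ab: "Re (a + b) > 0" using assms by simp
  \<comment> \<open>Integrating over x first yields \<open>Gamma b / u powr b\<close>, which reduces
    the exponent a + b - 1 of u to a - 1 and leaves the integrand of \<open>Gamma a\<close>.\<close>
  have pull: "gamma_kernel (a + b) 1 u / of_real u powr b = gamma_kernel a 1 u" for u
    by (cases "u > 0")
       (simp_all add: gamma_kernel_def of_real_powr_eq_exp algebra_simps flip: exp_diff)
  have npull: "norm (gamma_kernel (a + b) 1 u) / u powr Re b = norm (gamma_kernel a 1 u)" for u
    unfolding pull[symmetric] norm_divide
    by (cases "u > 0") (simp_all add: norm_powr_real_powr gamma_kernel_def)
  \<comment> \<open>For the other order, exp(-u) exp(-u x) is read as exp(-(1 + x) u): the integral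
    over u is then a gamma integral with scale 1 + x.\<close>
  have swap: "?F u x = gamma_kernel b 0 x * gamma_kernel (a + b) (1 + x) u" for u x
    by (cases "u > 0"; cases "x > 0")
       (simp_all add: gamma_kernel_def algebra_simps flip: exp_add)
  have [simp]: "gamma_kernel s p u = 0" if "\<not> u > 0" for s p u
    using that by (simp add: gamma_kernel_def)
  have int_x: "has_bochner_integral lborel (?F u) (Gamma b * gamma_kernel a 1 u)" for u
  proof (cases "u > 0")
    case True
    then show ?thesis
      using has_bochner_integral_mult_right[OF has_bochner_integral_gamma_kernel[OF assms(2) True],
          of "gamma_kernel (a + b) 1 u"]
      by (simp flip: pull add: mult_ac)
  qed (simp add: has_bochner_integral_zero)
  have int_nx: "has_bochner_integral lborel (\<lambda>x. norm (?F u x)) (Gamma (Re b) * norm (gamma_kernel a 1 u))" for u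
  proof (cases "u > 0")
    case True
    then show ?thesis
      using has_bochner_integral_mult_right[OF has_bochner_integral_norm_gamma_kernel[OF assms(2) True],
          of "norm (gamma_kernel (a + b) 1 u)"]
      by (simp flip: npull add: mult_ac norm_mult)
  qed (simp add: has_bochner_integral_zero)
  have int: "integrable (lborel \<Otimes>\<^sub>M lborel) (case_prod ?F)"
  proof (rule lborel_pair.Fubini_integrable)
    show "case_prod ?F \<in> borel_measurable (lborel \<Otimes>\<^sub>M lborel)"
      by measurable
    show "integrable lborel (\<lambda>u. LINT x|lborel. norm (case_prod ?F (u, x)))"
      using has_bochner_integral_norm_gamma_kernel[OF assms(1), of 1]
      by (simp add: has_bochner_integral_integral_eq[OF int_nx] has_bochner_integral_iff)
    show "AE u in lborel. integrable lborel (\<lambda>x. case_prod ?F (u, x))"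
      using int_x by (simp add: has_bochner_integral_iff)
  qed
  have int_u: "(LINT u|lborel. ?F u x) =
      Gamma (a + b) * (gamma_kernel b 0 x / of_real (1 + x) powr (a + b))" for x
  proof (cases "x > 0")
    case True
    then show ?thesis
      unfolding swap
      using has_bochner_integral_gamma_kernel[OF ab, of "1 + x", THEN has_bochner_integral_integral_eq]
      by simp
  qed simp
  have "has_bochner_integral lborel
      (\<lambda>x. Gamma (a + b) * (gamma_kernel b 0 x / of_real (1 + x) powr (a + b))) (Gamma a * Gamma b)"
    unfolding int_u[symmetric] has_bochner_integral_iff
  proof
    show "integrable lborel (\<lambda>x. LINT u|lborel. ?F u x)"
      by (rule lborel_pair.integrable_snd[OF int])
    have "(LINT x|lborel. LINT u|lborel. ?F u x) = (LINT u|lborel. LINT x|lborel. ?F u x)"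
      by (rule lborel_pair.Fubini_integral[OF int])
    also have "\<dots> = (LINT u|lborel. Gamma b * gamma_kernel a 1 u)"
      by (simp only: has_bochner_integral_integral_eq[OF int_x])
    also have "\<dots> = Gamma a * Gamma b"
      using has_bochner_integral_gamma_kernel[OF assms(1), of 1, THEN has_bochner_integral_integral_eq]
      by simp
    finally show "(LINT x|lborel. LINT u|lborel. ?F u x) = Gamma a * Gamma b" .
  qed
  then have "has_bochner_integral lborel
      (\<lambda>x. Gamma (a + b) * (gamma_kernel b 0 x / of_real (1 + x) powr (a + b)) / Gamma (a + b))
      (Gamma a * Gamma b / Gamma (a + b))"
    by (rule has_bochner_integral_divide_zero)
  \<comment> \<open>The gamma function has no zeros; \<open>Gamma\<close> takes the value 0 only by
    convention at its poles, which \<open>ab\<close> excludes.\<close>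
  moreover have "Gamma (a + b) \<noteq> 0"
    using ab by (auto simp: Gamma_eq_zero_iff simp del: plus_complex.sel elim!: nonpos_Ints_cases)
  ultimately show ?thesis
    by (simp add: Beta_def)
qed

text \<open>The substitution x = (1 - t) / t, for which 1 + x = 1 / t, carries the integral over the
  half-line to the unit interval.\<close>

lemma complex_Beta_integral:
  assumes "Re a > 0" "Re b > 0"
  shows "(\<lambda>t. of_real t powr (a - 1) * complex_of_real (1 - t) powr (b - 1))
           absolutely_integrable_on {0<..<1}" (is "?f absolutely_integrable_on _")
    and "integral {0<..<1} (\<lambda>t. of_real t powr (a - 1) * complex_of_real (1 - t) powr (b - 1)) = Beta a b"
proof -
  let ?h = "\<lambda>x. gamma_kernel b 0 x / of_real (1 + x) powr (a + b)"
  let ?g = "\<lambda>t::real. (1 - t) / t"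
  have restrict: "indicator {0<..} x *\<^sub>R ?h x = ?h x" for x
    by (simp add: gamma_kernel_def indicator_def)
  have "has_bochner_integral lebesgue ?h (Beta a b)"
    by (rule has_bochner_integral_lborel_imp_lebesgue complex_Beta_integral_Ioi assms)+
  then have h: "?h absolutely_integrable_on {0<..}" "(LINT x:{0<..}|lebesgue. ?h x) = Beta a b"
    unfolding has_bochner_integral_iff set_integrable_def set_lebesgue_integral_def restrict by auto
  then have "integral {0<..} ?h = Beta a b"
    using set_lebesgue_integral_eq_integral(2) by metis
  moreover have "?g ` {0<..<1} = {0<..}"
  proof -
    have "x = ?g (1 / (1 + x))" "1 / (1 + x) \<in> {0<..<1}" if "x > 0" for x :: real
      using that by (auto simp: field_simps)
    then have "{0<..} \<subseteq> ?g ` {0<..<1}"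
      by (blast intro: image_eqI)
    then show ?thesis by auto
  qed
  moreover have "inj_on ?g {0<..<1}"
    by (auto simp: inj_on_def field_simps)
  moreover have "(?g has_field_derivative - 1 / t\<^sup>2) (at t within {0<..<1})" if "t \<in> {0<..<1}" for t
    using that by (auto intro!: derivative_eq_intros simp: field_simps power2_eq_square)
  ultimately have *: "(\<lambda>t. \<bar>- 1 / t\<^sup>2\<bar> *\<^sub>R ?h (?g t)) absolutely_integrable_on {0<..<1}"
      "integral {0<..<1} (\<lambda>t. \<bar>- 1 / t\<^sup>2\<bar> *\<^sub>R ?h (?g t)) = Beta a b"
    using has_absolute_integral_change_of_variables_real[of "{0<..<1}" ?g "\<lambda>t. - 1 / t\<^sup>2" ?h "Beta a b"] h
    by auto
  have eq: "\<bar>- 1 / t\<^sup>2\<bar> *\<^sub>R ?h (?g t) = ?f t" if "t \<in> {0<..<1}" for t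
  proof -
    \<comment> \<open>Once every factor is an exponential, the identity only compares coefficients
      of \<open>ln t\<close> and \<open>ln (1 - t)\<close>. Later identities between powers are
      proved in the same way.\<close>
    have "\<bar>- 1 / t\<^sup>2\<bar> = exp (- 2 * ln t)" "1 + ?g t = 1 / t"
      using that by (auto simp: exp_minus exp_double divide_simps simp flip: ln_realpow)
    moreover have "gamma_kernel b 0 (?g t) = exp ((b - 1) * of_real (ln (1 - t) - ln t))"
      using that by (simp add: gamma_kernel_def ln_div)
    moreover have "complex_of_real (1 / t) powr (a + b) = exp ((a + b) * of_real (- ln t))"
      using that by (subst of_real_powr_eq_exp) (simp_all add: ln_div)
    ultimately have "\<bar>- 1 / t\<^sup>2\<bar> *\<^sub>R ?h (?g t) = exp (of_real (- 2 * ln t)) *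
        (exp ((b - 1) * of_real (ln (1 - t) - ln t)) / exp ((a + b) * of_real (- ln t)))"
      by (simp only: scaleR_conv_of_real exp_of_real)
    also have "\<dots> = ?f t"
      using that by (simp add: of_real_powr_eq_exp flip: exp_add exp_diff del: of_real_diff)
        (simp add: algebra_simps)
    finally show ?thesis .
  qed
  show "?f absolutely_integrable_on {0<..<1}"
    \<comment> \<open>Spiking on the empty set acts as a congruence rule, since the integrands agree
      on the whole interval.\<close>
    using *(1) by (rule absolutely_integrable_spike[OF _ negligible_empty]) (simp only: eq Diff_empty)
  show "integral {0<..<1} ?f = Beta a b"
    using *(2) by (simp only: integral_cong[OF eq])
qed

section \<open>The Lavoie--Trottier integral\<close>

text \<open>With \<open>a = lam + rho\<close> and \<open>b = lam\<close> this is the integrand of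
  the theorem without its Bessel factor. That case need not be integrable by itself, because Re lam
  may be nonpositive.\<close>

definition Lavoie_Trottier :: "complex \<Rightarrow> complex \<Rightarrow> real \<Rightarrow> complex" where
  "Lavoie_Trottier a b z = of_real z powr (a - 1) * of_real (1 - z) powr (2 * b - 1)
     * of_real (1 - z / 3) powr (2 * a - 1) * of_real (1 - z / 4) powr (b - 1)"

lemma has_integral_Lavoie_Trottier:
  assumes "Re a > 0" "Re b > 0"
  shows "Lavoie_Trottier a b absolutely_integrable_on {0<..<1}"
    and "(Lavoie_Trottier a b has_integral (2 / 3) powr (2 * a) * Beta a b) {0<..<1}"
proof -
  let ?f = "\<lambda>t. of_real t powr (a - 1) * complex_of_real (1 - t) powr (b - 1)"
  let ?g = "\<lambda>z::real. 9 / 4 * z * (1 - z / 3)\<^sup>2"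
  let ?g' = "\<lambda>z::real. 9 / 4 * (1 - z) * (1 - z / 3)"
  have compl: "1 - ?g z = (1 - z)\<^sup>2 * (1 - z / 4)" for z
    by (simp add: power2_eq_square field_simps)
  have d: "(?g has_field_derivative ?g' z) (at z within A)" for z A
    by (auto intro!: derivative_eq_intros simp: field_simps power2_eq_square)
  have "?g x < ?g y" if "0 < x" "x < y" "y < 1" for x y
    using that(2)
  proof (rule DERIV_pos_imp_increasing)
    show "\<exists>l. (?g has_real_derivative l) (at z) \<and> 0 < l" if "x \<le> z" "z \<le> y" for z
      using d[of z UNIV] that \<open>y < 1\<close> by (intro exI[of _ "?g' z"] conjI mult_pos_pos) auto
  qed
  then have inj: "inj_on ?g {0<..<1}"
    by (intro linorder_inj_onI) (force, auto)
  have im: "?g ` {0<..<1} = {0<..<1}"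
  proof safe
    fix w :: real assume "w \<in> {0<..<1}"
    \<comment> \<open>As 9/4 * (2/3)^2 = 1, the polynomial \<open>?g\<close> runs from 0 at 0 to 1
      at 1, and the intermediate value theorem applies.\<close>
    then have "\<exists>z\<ge>0. z \<le> 1 \<and> ?g z = w"
      by (intro IVT') (auto simp: power2_eq_square intro!: continuous_intros)
    then obtain z where "0 \<le> z" "z \<le> 1" "?g z = w"
      by auto
    moreover have "z \<noteq> 0" "z \<noteq> 1"
      using \<open>w \<in> _\<close> \<open>?g z = w\<close> by (auto simp: power2_eq_square)
    ultimately show "w \<in> ?g ` {0<..<1}"
      by (intro image_eqI[of _ _ z]) auto
  next
    fix z :: real assume z: "z \<in> {0<..<1}"
    then have "0 < 1 - ?g z"
      unfolding compl by simp
    then show "?g z \<in> {0<..<1}"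
      using z by simp
  qed
  have *: "(\<lambda>z. \<bar>?g' z\<bar> *\<^sub>R ?f (?g z)) absolutely_integrable_on {0<..<1}"
      "integral {0<..<1} (\<lambda>z. \<bar>?g' z\<bar> *\<^sub>R ?f (?g z)) = Beta a b"
    using has_absolute_integral_change_of_variables_real[of "{0<..<1}" ?g ?g' ?f "Beta a b", OF _ d inj]
      complex_Beta_integral[OF assms]
    unfolding im by auto
  have eq: "(2 / 3) powr (2 * a) * (\<bar>?g' z\<bar> *\<^sub>R ?f (?g z)) = Lavoie_Trottier a b z"
    if "z \<in> {0<..<1}" for z
  proof -
    \<comment> \<open>The Jacobian contributes 9/4 and the power of \<open>?g z\<close> contributes
      (9/4)^(a-1); the factor (2/3)^(2a) = (4/9)^a cancels both. Its logarithm is expressed through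
      \<open>?l\<close> to make the cancellation linear.\<close>
    let ?l = "ln (9 / 4 :: real)"
    have "?l = ln ((3 / 2)\<^sup>2)"
      by (simp add: power2_eq_square)
    also have "\<dots> = - 2 * ln (2 / 3)"
      by (subst ln_realpow) (auto simp: ln_div)
    finally have l: "ln (2 / 3) = - ?l / 2"
      by simp
    have "(2 / 3) powr (2 * a) = exp (2 * a * of_real (- ?l / 2))"
      using of_real_powr_eq_exp[of "2 / 3" "2 * a"] by (simp only: l) simp
    moreover have "\<bar>?g' z\<bar> = exp (?l + ln (1 - z) + ln (1 - z / 3))"
      using that by (simp add: exp_add)
    moreover have "complex_of_real (?g z) powr (a - 1) =
        exp ((a - 1) * of_real (?l + ln z + 2 * ln (1 - z / 3)))"
    proof -
      have "ln (?g z) = ?l + ln z + 2 * ln (1 - z / 3)"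
        using that ln_mult[of "9 / 4 * z" "(1 - z / 3)\<^sup>2"] ln_mult[of "9 / 4" z]
        by (simp only: ln_realpow) simp
      then show ?thesis
        using that by (subst of_real_powr_eq_exp) simp_all
    qed
    moreover have "complex_of_real (1 - ?g z) powr (b - 1) =
        exp ((b - 1) * of_real (2 * ln (1 - z) + ln (1 - z / 4)))"
      using that unfolding compl
      by (subst of_real_powr_eq_exp) (simp_all add: ln_mult ln_realpow)
    ultimately have "(2 / 3) powr (2 * a) * (\<bar>?g' z\<bar> *\<^sub>R ?f (?g z)) =
        exp (2 * a * of_real (- ?l / 2)) * (exp (of_real (?l + ln (1 - z) + ln (1 - z / 3))) *
          (exp ((a - 1) * of_real (?l + ln z + 2 * ln (1 - z / 3))) *
           exp ((b - 1) * of_real (2 * ln (1 - z) + ln (1 - z / 4)))))"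
      by (simp only: scaleR_conv_of_real exp_of_real)
    also have "\<dots> = Lavoie_Trottier a b z"
      using that
      by (simp add: Lavoie_Trottier_def of_real_powr_eq_exp flip: exp_add del: of_real_diff of_real_divide)
         (simp add: algebra_simps)
    finally show ?thesis .
  qed
  have "(\<lambda>z. (2 / 3) powr (2 * a) * (\<bar>?g' z\<bar> *\<^sub>R ?f (?g z))) absolutely_integrable_on {0<..<1}"
    using *(1) by (rule set_integrable_mult_right)
  then show "Lavoie_Trottier a b absolutely_integrable_on {0<..<1}"
    by (rule absolutely_integrable_spike[OF _ negligible_empty]) (simp only: eq Diff_empty)
  have "((\<lambda>z. (2 / 3) powr (2 * a) * (\<bar>?g' z\<bar> *\<^sub>R ?f (?g z))) has_integral
      (2 / 3) powr (2 * a) * Beta a b) {0<..<1}"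
    using * set_lebesgue_integral_eq_integral(1)
    by (intro has_integral_mult_right) (simp add: has_integral_iff)
  then show "(Lavoie_Trottier a b has_integral (2 / 3) powr (2 * a) * Beta a b) {0<..<1}"
    by (rule has_integral_eq[rotated]) (simp only: eq)
qed

text \<open>Raising b by c adds 2c to the exponent of 1 - z and c to that of 1 - z/4. Each Bessel
  term is thereby absorbed into the second parameter.\<close>

lemma Lavoie_Trottier_shift:
  assumes "z \<in> {0<..<1}"
  shows "Lavoie_Trottier a (b + c) z = of_real ((1 - z / 4) * (1 - z)\<^sup>2) powr c * Lavoie_Trottier a b z"
proof -
  have "complex_of_real ((1 - z / 4) * (1 - z)\<^sup>2) powr c = exp (c * of_real (2 * ln (1 - z) + ln (1 - z / 4)))"
    using assms by (subst of_real_powr_eq_exp) (simp_all add: ln_mult ln_realpow add.commute)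
  then show ?thesis
    using assms
    by (simp add: Lavoie_Trottier_def of_real_powr_eq_exp flip: exp_add del: of_real_diff of_real_divide of_real_mult)
       (simp add: algebra_simps)
qed

section \<open>Termwise integration\<close>

text \<open>Consecutive terms have ratio x / ((a + n)(n + 1)). Since |a + n| >= n, its modulus is at
  most 1/2 once n >= 2 |x|.\<close>

lemma summable_norm_Bessel_coeff:
  fixes a x :: complex
  assumes "Re a > 0"
  shows "summable (\<lambda>n. norm (x ^ n / (Gamma (a + of_nat n) * fact n)))"
proof (rule summable_ratio_test)
  fix n assume n: "nat \<lceil>2 * norm x\<rceil> \<le> n"
  let ?c = "\<lambda>n. x ^ n / (Gamma (a + of_nat n) * fact n)"
  have "2 * norm x \<le> real n"
    using n by linarith
  also have "real n \<le> Re (a + of_nat n)"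
    using assms by simp
  also have "\<dots> \<le> norm (a + of_nat n)"
    by (rule complex_Re_le_cmod)
  finally have "2 * norm x \<le> norm (a + of_nat n) * 1"
    by simp
  also have "\<dots> \<le> norm (a + of_nat n) * norm (of_nat (Suc n) :: complex)"
    by (intro mult_left_mono) (simp_all add: norm_of_nat del: of_nat_Suc)
  finally have le: "2 * norm x \<le> norm ((a + of_nat n) * of_nat (Suc n))"
    by (simp only: norm_mult)
  have "Re (a + of_nat n) > 0"
    using assms by simp
  then have nz: "a + of_nat n \<notin> \<int>\<^sub>\<le>\<^sub>0" "a + of_nat n \<noteq> 0"
    by (auto simp del: plus_complex.sel elim!: nonpos_Ints_cases)
  then have "?c (Suc n) = x / ((a + of_nat n) * of_nat (Suc n)) * ?c n"
    using Gamma_plus1[of "a + of_nat n"] by (simp add: add_ac mult_ac)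
  then have "norm (?c (Suc n)) = norm (x / ((a + of_nat n) * of_nat (Suc n))) * norm (?c n)"
    by (simp only: norm_mult)
  moreover have "norm (x / ((a + of_nat n) * of_nat (Suc n))) \<le> 1 / 2"
    using le nz unfolding norm_divide by (subst divide_le_eq) (auto simp del: of_nat_Suc)
  ultimately show "norm (norm (?c (Suc n))) \<le> 1 / 2 * norm (norm (?c n))"
    by (metis abs_norm_cancel mult_right_mono norm_ge_zero real_norm_def)
qed simp

text \<open>Even powers of a base in (0, 1] have modulus at most 1, so all partial sums share one
  integrable majorant. Dominated convergence gives the summability of the integrals as well, which
  is needed later to take a constant out of their sum.\<close>

lemma has_integral_Lavoie_Trottier_series:
  fixes c :: "nat \<Rightarrow> complex"
  assumes "Re a > 0" "Re b > 0" and c: "summable (\<lambda>n. norm (c n))"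
  defines "F \<equiv> \<lambda>n z. c n * Lavoie_Trottier a (b + 2 * of_nat n) z"
    and "C \<equiv> (2 / 3) powr (2 * a)"
  shows "\<And>z. z \<in> {0<..<1} \<Longrightarrow> summable (\<lambda>n. F n z)"
    and "((\<lambda>z. \<Sum>n. F n z) has_integral (\<Sum>n. c n * (C * Beta a (b + 2 * of_nat n)))) {0<..<1}"
    and "summable (\<lambda>n. c n * (C * Beta a (b + 2 * of_nat n)))"
proof -
  let ?I = "\<lambda>n. c n * (C * Beta a (b + 2 * of_nat n))"
  have term_le: "norm (F n z) \<le> norm (c n) * norm (Lavoie_Trottier a b z)" if "z \<in> {0<..<1}" for n z
  proof -
    let ?r = "(1 - z / 4) * (1 - z)\<^sup>2"
    have "0 < ?r" "?r \<le> 1"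
      using that by (auto intro!: mult_le_one power_le_one)
    then have "norm (complex_of_real ?r powr (2 * of_nat n)) \<le> 1"
      using powr_mono2[of "2 * real n" ?r 1] by (simp add: norm_powr_real_powr)
    then have "norm (Lavoie_Trottier a (b + 2 * of_nat n) z) \<le> 1 * norm (Lavoie_Trottier a b z)"
      unfolding Lavoie_Trottier_shift[OF that] norm_mult by (rule mult_right_mono) simp
    then show ?thesis
      by (simp add: F_def norm_mult mult_left_mono)
  qed
  show summable: "summable (\<lambda>n. F n z)" if "z \<in> {0<..<1}" for z
    using term_le[OF that] by (rule summable_comparison_test'[OF summable_mult2[OF c]])
  have I: "(F n has_integral ?I n) {0<..<1}" for n
    unfolding F_def C_def using assms
    by (intro has_integral_mult_right has_integral_Lavoie_Trottier) simp_all
  let ?S = "\<lambda>N z. \<Sum>n<N. F n z"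
  have S: "(?S N has_integral (\<Sum>n<N. ?I n)) {0<..<1}" for N
    by (intro has_integral_sum I) simp
  have dom: "(\<lambda>z. (\<Sum>n. norm (c n)) * norm (Lavoie_Trottier a b z)) integrable_on {0<..<1}"
    using has_integral_Lavoie_Trottier(1)[OF assms(1,2)]
    by (intro integrable_on_mult_right) (simp add: absolutely_integrable_on_def)
  have bound: "norm (?S N z) \<le> (\<Sum>n. norm (c n)) * norm (Lavoie_Trottier a b z)"
    if "z \<in> {0<..<1}" for N z
  proof -
    have "norm (?S N z) \<le> (\<Sum>n<N. norm (c n) * norm (Lavoie_Trottier a b z))"
      using term_le[OF that] by (intro sum_norm_le) simp
    also have "\<dots> \<le> (\<Sum>n. norm (c n)) * norm (Lavoie_Trottier a b z)"
      unfolding sum_distrib_right[symmetric]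
      by (intro mult_right_mono sum_le_suminf c) simp_all
    finally show ?thesis .
  qed
  have lim: "(\<lambda>N. ?S N z) \<longlonglongrightarrow> (\<Sum>n. F n z)" if "z \<in> {0<..<1}" for z
    using summable[OF that] by (rule summable_LIMSEQ)
  note dc = dominated_convergence[OF _ dom bound lim, OF has_integral_integrable[OF S]]
  have "?I sums integral {0<..<1} (\<lambda>z. \<Sum>n. F n z)"
    using dc(2) unfolding integral_unique[OF S] sums_def .
  then show "summable ?I"
    and "((\<lambda>z. \<Sum>n. F n z) has_integral suminf ?I) {0<..<1}"
    using dc(1) by (auto simp: sums_iff has_integral_iff)
qed

section \<open>Expansion of the k-Bessel function\<close>

lemma cpow_real_mult:
  assumes "r > 0"
  shows "cpow (of_real r * x) s = of_real r powr s * cpow x s"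
  using assms by (auto simp: cpow_def powr_times_real_left)

text \<open>The delicate case is x = 0: an exponent s + 2n = 0 with n > 0 would give 1 on the left
  and 0 on the right. The bound on Re s excludes it.\<close>

lemma cpow_add_even:
  assumes "Re s > -1"
  shows "cpow x (s + 2 * of_nat n) = cpow x s * (x\<^sup>2) ^ n"
proof (cases "n = 0")
  case False
  then have "Re (s + 2 * of_nat n) > 0"
    using assms by simp
  then have "s + 2 * of_nat n \<noteq> 0"
    by (auto simp del: plus_complex.sel)
  moreover have "x powr (2 * of_nat n) = (x\<^sup>2) ^ n" if "x \<noteq> 0"
    using that powr_nat'[of x "2 * n"] by (simp add: power_mult)
  ultimately show ?thesis
    using False by (cases "x = 0") (auto simp: cpow_def powr_add add_eq_0_iff2)
qed simp

text \<open>Separates the complex parameter y, possibly 0, from the positive factor r that depends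
  on z. The k-gamma value contributes k^(m+n): k^m goes into the prefactor and k^n into the argument
  -y^2 / (4k).\<close>

lemma k_Bessel_scaled:
  assumes "k > 0" "Re (v / of_real k) > -1" "r > 0"
  defines "m \<equiv> v / of_real k"
  shows "k_Bessel k v (y * of_real r) = (\<Sum>n. cpow (y / 2) m / of_real k powr m *
           ((- (y\<^sup>2) / (4 * of_real k)) ^ n / (Gamma (m + 1 + of_nat n) * fact n) *
            of_real r powr (m + 2 * of_nat n)))"
  unfolding k_Bessel_def
proof (rule suminf_cong)
  fix n
  let ?s = "v + of_nat n * of_real k + of_real k"
  have s: "?s / of_real k = m + 1 + of_nat n"
    using \<open>k > 0\<close> by (simp add: m_def field_simps)
  have "Re (m + 1 + of_nat n) > 0"
    using assms(2) by (simp add: m_def)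
  then have "Re ?s > 0"
    using \<open>k > 0\<close> unfolding s[symmetric] by (simp add: zero_less_divide_iff)
  then have "k_Gamma k ?s = of_real k powr (m + of_nat n) * Gamma (m + 1 + of_nat n)"
    using k_Gamma_eq[OF \<open>k > 0\<close>, of ?s] unfolding s by simp
  also have "of_real k powr (m + of_nat n) = of_real k powr m * of_real k ^ n"
    using \<open>k > 0\<close> by (simp add: powr_add powr_nat')
  finally have G: "k_Gamma k ?s = of_real k powr m * of_real k ^ n * Gamma (m + 1 + of_nat n)" .
  have x: "y * of_real r / 2 = of_real r * (y / 2)"
    by simp
  have P: "cpow (y * of_real r / 2) (m + 2 * of_nat n) =
      of_real r powr (m + 2 * of_nat n) * (cpow (y / 2) m * (y\<^sup>2 / 4) ^ n)"
    using assms(2) cpow_add_even[of m "y / 2" n] unfolding x cpow_real_mult[OF \<open>r > 0\<close>]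
    by (simp add: m_def power_divide)
  have "(- (y\<^sup>2) / (4 * of_real k)) ^ n = (-1) ^ n * (y\<^sup>2 / 4) ^ n / of_real k ^ n"
    by (simp flip: power_mult_distrib power_divide)
  then show "(-1) ^ n / (k_Gamma k ?s * fact n) * cpow (y * of_real r / 2) (v / of_real k + 2 * of_nat n) =
      cpow (y / 2) m / of_real k powr m *
           ((- (y\<^sup>2) / (4 * of_real k)) ^ n / (Gamma (m + 1 + of_nat n) * fact n) *
            of_real r powr (m + 2 * of_nat n))"
    unfolding G m_def[symmetric] P by (simp add: mult_ac)
qed

section \<open>Identification of the integrated Bessel series with the Wright function\<close>

theorem corollary3p2:
  fixes k :: real and lam rho v y :: complex
  assumes "k > 0"
    and "Re (v / of_real k) > -1"
    and "Re (lam + rho) > 0"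
    and "Re (lam + v / of_real k) > 0"
  shows "((\<lambda>z::real.
            of_real z powr (lam + rho - 1)
            * of_real (1 - z) powr (2 * lam - 1)
            * of_real (1 - z / 3) powr (2 * (lam + rho) - 1)
            * of_real (1 - z / 4) powr (lam - 1)
            * k_Bessel k v (y * of_real (1 - z / 4) * of_real (1 - z) ^ 2))
          has_integral
            (cpow (y / 2) (v / of_real k) * Gamma (lam + rho) * (2 / 3) powr (2 * (lam + rho))
             / of_real k powr (v / of_real k)
             * Wright_1Psi2 (lam + v / of_real k, 2) (v / of_real k + 1, 1)
                 (2 * lam + v / of_real k + rho, 2) (- (y ^ 2) / (4 * of_real k))))
         {0..1}"
proof -
  define a m where "a = lam + rho" and "m = v / of_real k"
  define c where "c n = (- (y\<^sup>2) / (4 * of_real k)) ^ n / (Gamma (m + 1 + of_nat n) * fact n)" for n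
  let ?C = "(2 / 3) powr (2 * a) :: complex"
  let ?D = "cpow (y / 2) m / of_real k powr m"
  let ?w = "\<lambda>n. c n * (Gamma (lam + m + 2 * of_nat n) / Gamma (a + (lam + m) + 2 * of_nat n))"
  let ?f = "\<lambda>z. of_real z powr (lam + rho - 1) * of_real (1 - z) powr (2 * lam - 1)
            * of_real (1 - z / 3) powr (2 * (lam + rho) - 1) * of_real (1 - z / 4) powr (lam - 1)
            * k_Bessel k v (y * of_real (1 - z / 4) * of_real (1 - z) ^ 2)"
  \<comment> \<open>The second parameter starts at \<open>lam + m\<close>, with the factor of the
    term n = 0 already included; the hypotheses make its real part positive.\<close>
  have pos: "Re a > 0" "Re (lam + m) > 0" and m: "Re (m + 1) > 0"
    using assms by (simp_all add: a_def m_def)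
  have c: "summable (\<lambda>n. norm (c n))"
    using summable_norm_Bessel_coeff[OF m] by (simp add: c_def)
  note series = has_integral_Lavoie_Trottier_series[OF pos c]
  \<comment> \<open>Writing the beta function as a gamma quotient, \<open>Gamma a\<close> is
    independent of n, and the remaining quotient supplies the two Wright parameters with step
    2.\<close>
  have I: "c n * (?C * Beta a (lam + m + 2 * of_nat n)) = ?C * Gamma a * ?w n" for n
    by (simp add: Beta_def add.assoc)
  have "?C * Gamma a \<noteq> 0"
    using pos(1) by (auto simp: Gamma_eq_zero_iff elim!: nonpos_Ints_cases)
  then have "summable ?w"
    using series(3) unfolding I by (simp only: summable_cmult_iff) simp
  then have W: "(\<Sum>n. c n * (?C * Beta a (lam + m + 2 * of_nat n))) = ?C * Gamma a * suminf ?w"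
    unfolding I by (rule suminf_mult)
  have f_eq: "?D * (\<Sum>n. c n * Lavoie_Trottier a (lam + m + 2 * of_nat n) z) = ?f z"
    if z: "z \<in> {0<..<1}" for z
  proof -
    let ?r = "(1 - z / 4) * (1 - z)\<^sup>2"
    let ?L = "Lavoie_Trottier a lam z"
    have r: "?r > 0" using z by simp
    have eq: "(\<lambda>n. c n * Lavoie_Trottier a (lam + m + 2 * of_nat n) z) =
        (\<lambda>n. ?L * (c n * of_real ?r powr (m + 2 * of_nat n)))"
      using Lavoie_Trottier_shift[OF z, of a lam "m + 2 * of_nat _"] by (simp add: add.assoc mult_ac)
    \<comment> \<open>Summability of the Bessel terms follows from that of the integrands on
      division by \<open>?L\<close>, which is nonzero inside the interval.\<close>
    have "summable (\<lambda>n. ?L * (c n * of_real ?r powr (m + 2 * of_nat n)))"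
      using series(1)[OF z] unfolding eq .
    moreover have "?L \<noteq> 0"
      using z by (simp add: Lavoie_Trottier_def of_real_powr_eq_exp del: of_real_diff of_real_divide)
    ultimately have "summable (\<lambda>n. c n * of_real ?r powr (m + 2 * of_nat n))"
      by (simp only: summable_cmult_iff) simp
    note pull = suminf_mult[OF this]
    have "?D * (\<Sum>n. c n * Lavoie_Trottier a (lam + m + 2 * of_nat n) z) =
        ?L * (\<Sum>n. ?D * (c n * of_real ?r powr (m + 2 * of_nat n)))"
      unfolding eq pull by (rule mult.left_commute)
    also have "\<dots> = ?L * k_Bessel k v (y * of_real ?r)"
      using k_Bessel_scaled[OF assms(1,2) r, of y] by (simp only: c_def m_def)
    also have "\<dots> = ?f z"
      by (simp add: Lavoie_Trottier_def a_def mult.assoc)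
    finally show ?thesis .
  qed
  have "((\<lambda>z. ?D * (\<Sum>n. c n * Lavoie_Trottier a (lam + m + 2 * of_nat n) z))
      has_integral ?D * (?C * Gamma a * suminf ?w)) {0<..<1}"
    using series(2) unfolding W by (rule has_integral_mult_right)
  then have "(?f has_integral ?D * (?C * Gamma a * suminf ?w)) {0<..<1}"
    by (rule has_integral_eq[rotated]) (rule f_eq)
  then have "(?f has_integral ?D * (?C * Gamma a * suminf ?w)) {0..1}"
    by (simp only: has_integral_Icc_iff_Ioo)
  moreover have "suminf ?w = Wright_1Psi2 (lam + m, 2) (m + 1, 1) (2 * lam + m + rho, 2)
      (- (y\<^sup>2) / (4 * of_real k))"
    unfolding Wright_1Psi2_def by (simp add: c_def a_def mult_ac add_ac)
  ultimately show ?thesis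
    by (simp add: a_def m_def mult_ac)
qed

end
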